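(* For every $\varepsilon$ with $0<\varepsilon<2$ there exist a constant $c>0$ and an integer $N$ such that for every integer $n\ge N$: (i) there is a carefully synchronizing PFA on $n$ states and three symbols whose shortest carefully synchronizing word has length at least $c\,(2-\varepsilon)^{2n/5}$; and (ii) there is a carefully synchronizing PFA on $n$ states and two symbols whose shortest carefully synchronizing word has length at least $c\,(2-\varepsilon)^{n/3}$.
   Context: A partial finite automaton (PFA) over a finite alphabet $\Sigma$ consists of a finite set $Q$ of states and a partial map $\delta : Q\times\Sigma \to Q$. For $q\in Q$, $w\in\Sigma^*$, $a\in\Sigma$ define $q\lambda = q$ for the empty word $\lambda$, and $q(wa) = \delta(qw,a)$, which is defined only if $qw$ is defined and $\delta(qw,a)$ is defined. A word $w\in\Sigma^*$ is carefully synchronizing if there is a state $q_s\in Q$ such that $qw$ is defined and $qw = q_s$ for all $q \in Q$. A PFA is carefully synchronizing if it admits a carefully synchronizing word. *)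

theory Defs
  imports Complex_Main
begin

locale pfa =
  fixes Q :: "'q set" and \<Sigma> :: "'a set" and \<delta> :: "'q \<times> 'a \<rightharpoonup> 'q"
  assumes finite_states: "finite Q"
    and finite_alphabet: "finite \<Sigma>"
    and dom_delta: "dom \<delta> \<subseteq> Q \<times> \<Sigma>"
    and ran_delta: "ran \<delta> \<subseteq> Q"

(* run \<delta> q w is the paper's "q w"; None means undefined.  The last letter of w is
   applied last, see run_snoc. *)
definition run :: "('q \<times> 'a \<rightharpoonup> 'q) \<Rightarrow> 'q \<Rightarrow> 'a list \<Rightarrow> 'q option" where
  "run \<delta> q w = foldl (\<lambda>s a. Option.bind s (\<lambda>p. \<delta> (p, a))) (Some q) w"

lemma run_Nil: "run \<delta> q [] = Some q"
  by (simp add: run_def)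

lemma run_snoc: "run \<delta> q (w @ [a]) = Option.bind (run \<delta> q w) (\<lambda>p. \<delta> (p, a))"
  by (simp add: run_def)

definition careful_sync_word ::
  "'q set \<Rightarrow> 'a set \<Rightarrow> ('q \<times> 'a \<rightharpoonup> 'q) \<Rightarrow> 'a list \<Rightarrow> bool" where
  "careful_sync_word Q \<Sigma> \<delta> w \<longleftrightarrow>
     w \<in> lists \<Sigma> \<and> (\<exists>q\<^sub>s\<in>Q. \<forall>q\<in>Q. run \<delta> q w = Some q\<^sub>s)"

definition carefully_synchronizing ::
  "'q set \<Rightarrow> 'a set \<Rightarrow> ('q \<times> 'a \<rightharpoonup> 'q) \<Rightarrow> bool" where
  "carefully_synchronizing Q \<Sigma> \<delta> \<longleftrightarrow> (\<exists>w. careful_sync_word Q \<Sigma> \<delta> w)"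

(* Only meaningful for carefully synchronizing automata; otherwise the value is unspecified. *)
definition shortest_sync_length ::
  "'q set \<Rightarrow> 'a set \<Rightarrow> ('q \<times> 'a \<rightharpoonup> 'q) \<Rightarrow> nat" where
  "shortest_sync_length Q \<Sigma> \<delta> =
     (LEAST l. \<exists>w. careful_sync_word Q \<Sigma> \<delta> w \<and> length w = l)"

end

theory Submission
  imports Defs
begin

text \<open>
  The automaton is an odometer operated by two letters: \<open>0\<close> turns a ring, \<open>1\<close> advances a counter at
  its head. The ring has \<open>M + 1\<close> cells. A cell holds a digit in base 16, stored as four independent
  bits, and each bit is a pair of states of which a configuration contains exactly one. A further
  state of the configuration tells how far the ring has been turned, and another one the phase. So a
  configuration is a set of \<open>4 (M + 1) + 2\<close> states, and a letter that is undefined on one of them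
  cannot be used there: undefinedness enforces the rules of the odometer.

  A word is read as a sequence of blocks \<open>1\<^sup>k 0\<close>. The number \<open>k\<close>, capped at 8, selects an operation
  on the digit at the head, after which the ring turns by one cell:
  \<^item> 0 \<^emph>\<open>start\<close>: allowed only when the ring stands at position \<open>M\<close>; begins an increment (phase
    \<open>Copy\<close> to \<open>Carry\<close>) or, if a carry has come that far, ends the counting (\<open>Carry\<close> to \<open>Finish\<close>);
  \<^item> 1 \<^emph>\<open>copy\<close>: keeps the digit, in phase \<open>Copy\<close>;
  \<^item> 2 to 5 \<^emph>\<open>increment\<close>: bits below \<open>k - 2\<close> go from 1 to 0, bit \<open>k - 2\<close> goes from 0 to 1, and phase
    \<open>Carry\<close> becomes \<open>Copy\<close>;
  \<^item> 6 \<^emph>\<open>carry\<close>: the digit 15 becomes 0, and the phase \<open>Carry\<close> is kept;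
  \<^item> 7 \<^emph>\<open>erase\<close>: in phase \<open>Finish\<close>, the states at the head collapse into the phase state;
  \<^item> 8 \<^emph>\<open>reset\<close>: allowed always; the digit becomes 0 and the phase \<open>Copy\<close>. This operation alone
    is defined on the full state set.

  Give the digit at position \<open>p < M\<close> the weight \<open>16\<^sup>p\<close> and a pending carry at position
  \<open>p \<le> M\<close> likewise \<open>16\<^sup>p\<close>. The resulting potential grows by at most 1 per letter (\<open>potential_step\<close>), because only the
  start operation increases it. No configuration is a singleton before phase \<open>Finish\<close>, and
  this phase requires a carry at position \<open>M\<close>, of weight \<open>16\<^sup>M\<close>. A word that synchronizes all
  states synchronizes in particular the zero configuration, so it has length at least \<open>16\<^sup>M\<close>
  (\<open>sync_word_length\<close>). Conversely, \<open>M + 2\<close> resets send the full state set into the zero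
  configuration (\<open>reset\<close>), counting then reaches the final carry (\<open>count_up\<close>), and \<open>M + 1\<close> erasures
  merge everything (\<open>finish\<close>).

  The bits cost 8 states per cell and the position 2, all else is a constant. With \<open>n\<close> about \<open>10 M\<close>
  states the bound is \<open>16\<^sup>M\<close>, about \<open>2\<close> to the power \<open>2 n / 5\<close>, already for two letters. A third
  letter that is nowhere defined changes nothing, hence the same automaton serves both claims.
\<close>

section \<open>The odometer automaton\<close>

datatype phase = Copy | Carry | Finish
text \<open>
  The last argument of each of the first three constructors counts the letters \<open>1\<close> since the last
  rotation. \<open>Bit c i b j\<close> says that bit \<open>i\<close> of the digit in cell \<open>c\<close> is \<open>b\<close>, where cell 0 is the head.
  Spare states only serve to adjust the number of states.
\<close>
datatype state = Bit nat nat bool nat | Phase phase nat | Position nat nat | Spare nat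

fun new_bit :: "nat \<Rightarrow> nat \<Rightarrow> bool \<Rightarrow> bool option" where
  "new_bit j i b =
     (if j \<le> 1 then Some b
      else if 8 \<le> j then Some False
      else if i + 2 < j then (if b then Some False else None)
      else if i + 2 = j then (if b then None else Some True)
      else Some b)"

context
  fixes M l :: nat
begin

text \<open>
  Every counter is present only where its value matters. A position \<open>p < M\<close> merely needs to reject
  the start operation, for which two values suffice; this is what keeps the cost per cell at ten
  states.
\<close>
fun legal :: "state \<Rightarrow> bool" where
  "legal (Bit c i b j) \<longleftrightarrow> c \<le> M \<and> i < 4 \<and> j \<le> (if c = 0 then 8 else 0)"
| "legal (Phase x j) \<longleftrightarrow> j \<le> 8"
| "legal (Position p j) \<longleftrightarrow> p \<le> M \<and> j \<le> (if p = M then 8 else 1)"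
| "legal (Spare k) \<longleftrightarrow> k < l"

text \<open>
  The value 8 sends a spare state directly to where eight letters \<open>1\<close> lead from \<open>Phase Copy\<close>, so
  that the first reset absorbs it.
\<close>
fun count :: "state \<Rightarrow> state" where
  "count (Bit c i b j) = Bit c i b (min (Suc j) (if c = 0 then 8 else 0))"
| "count (Phase x j) = Phase x (min (Suc j) 8)"
| "count (Position p j) = Position p (min (Suc j) (if p = M then 8 else 1))"
| "count (Spare k) = Phase Copy 8"

text \<open>
  The ring turns toward the head, the head digit going to cell \<open>M\<close>. A reset leaves position \<open>M\<close> in
  place, which makes repeated resets merge all positions. The digits then move relative to the
  position, but toward lower weights.
\<close>
fun rotate :: "state \<Rightarrow> state option" where
  "rotate (Bit c i b j) =
     (if 0 < c then Some (Bit (c - 1) i b 0)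
      else if j = 7 then Some (Phase Finish 0)
      else map_option (\<lambda>b'. Bit M i b' 0) (new_bit j i b))"
| "rotate (Phase x j) =
     (if 8 \<le> j then Some (Phase Copy 0)
      else case x of
        Copy \<Rightarrow> if j = 0 then Some (Phase Carry 0) else if j = 1 then Some (Phase Copy 0) else None
      | Carry \<Rightarrow> if j = 0 then Some (Phase Finish 0) else if 2 \<le> j \<and> j \<le> 5 then Some (Phase Copy 0)
                 else if j = 6 then Some (Phase Carry 0) else None
      | Finish \<Rightarrow> if j = 7 then Some (Phase Finish 0) else None)"
| "rotate (Position p j) =
     (if p < M then (if j = 0 then None else Some (Position (Suc p) 0))
      else if j < 7 then Some (Position 0 0)
      else if j = 7 then Some (Phase Finish 0)
      else Some (Position M 0))"
| "rotate (Spare k) = None"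

definition states :: "state set" where
  "states = Collect legal"

definition delta :: "state \<times> nat \<rightharpoonup> state" where
  "delta = (\<lambda>(q, a). if \<not> legal q then None
     else if a = 0 then rotate q else if a = 1 then Some (count q) else None)"

lemma legal_count: "legal q \<Longrightarrow> legal (count q)"
  by (cases q) auto

lemma legal_rotate: "legal q \<Longrightarrow> rotate q = Some q' \<Longrightarrow> legal q'"
  by (cases q) (auto split: if_splits phase.splits)

lemma foldl_bind_None: "foldl (\<lambda>s a. Option.bind s (\<lambda>p. d (p, a))) None w = None"
  by (induction w) auto

lemma run_Cons: "run d q (a # w) = Option.bind (d (q, a)) (\<lambda>q'. run d q' w)"
  by (cases "d (q, a)") (auto simp: run_def foldl_bind_None)

lemma run_append: "run d q (u @ v) = Option.bind (run d q u) (\<lambda>q'. run d q' v)"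
  by (induction u arbitrary: q) (auto simp: run_Cons run_Nil bind_eq_Some_conv split: bind_splits)

lemma delta_apply: "legal q \<Longrightarrow> delta (q, 0) = rotate q" "legal q \<Longrightarrow> delta (q, 1) = Some (count q)"
  by (simp_all add: delta_def)

section \<open>Configurations\<close>

text \<open>
  Here \<open>j\<close> is the uncapped number of letters \<open>1\<close> since the last rotation. The digit array \<open>D\<close> is
  indexed by cell and bit, and the cells are those of the ring as it currently stands, so that the digit
  at the head is \<open>D 0\<close>.
\<close>
definition config :: "phase \<Rightarrow> nat \<Rightarrow> nat \<Rightarrow> (nat \<Rightarrow> nat \<Rightarrow> bool) \<Rightarrow> state set" where
  "config x p j D =
     (\<lambda>(c, i). Bit c i (D c i) (min j (if c = 0 then 8 else 0))) ` ({..M} \<times> {..<4})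
     \<union> {Phase x (min j 8), Position p (min j (if p = M then 8 else 1))}"

definition shift :: "(nat \<Rightarrow> nat \<Rightarrow> bool) \<Rightarrow> (nat \<Rightarrow> bool) \<Rightarrow> nat \<Rightarrow> nat \<Rightarrow> bool" where
  "shift D f c = (if c < M then D (Suc c) else f)"

lemma config_legal: "p \<le> M \<Longrightarrow> q \<in> config x p j D \<Longrightarrow> legal q"
  by (auto simp: config_def)

lemma count_config:
  assumes "p \<le> M"
  shows "(\<lambda>q. delta (q, 1)) ` config x p j D = Some ` config x p (Suc j) D"
proof -
  have "(\<lambda>q. delta (q, 1)) ` config x p j D = (\<lambda>q. Some (count q)) ` config x p j D"
    using config_legal[OF assms] by (intro image_cong) (auto simp: delta_def)
  also have "\<dots> = Some ` config x p (Suc j) D"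
    by (auto simp: config_def image_Un image_image case_prod_unfold)
  finally show ?thesis .
qed

text \<open>Operation 7 is excluded because erasing does not lead to a configuration.\<close>
lemma rotate_config:
  assumes "p \<le> M" "min j 8 \<noteq> 7" "p' \<le> M"
    and digit: "\<And>i. i < 4 \<Longrightarrow> new_bit (min j 8) i (D 0 i) = Some (f i)"
    and phase: "rotate (Phase x (min j 8)) = Some (Phase x' 0)"
    and pos: "rotate (Position p (min j (if p = M then 8 else 1))) = Some (Position p' 0)"
  shows "(\<lambda>q. delta (q, 0)) ` config x p j D = Some ` config x' p' 0 (shift D f)"
proof -
  let ?d = "\<lambda>j (D :: nat \<Rightarrow> nat \<Rightarrow> bool) (c, i). Bit c i (D c i) (min j (if c = 0 then 8 else 0))"
  have "(\<lambda>q. delta (q, 0)) ` config x p j D = rotate ` config x p j D"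
    using config_legal[OF assms(1)] by (intro image_cong) (auto simp: delta_def)
  also have "\<dots> = rotate ` ?d j D ` ({..M} \<times> {..<4}) \<union> {Some (Phase x' 0), Some (Position p' 0)}"
    unfolding config_def image_Un using phase pos by auto
  also have "rotate ` ?d j D ` ({..M} \<times> {..<4}) = Some ` ?d 0 (shift D f) ` ({..M} \<times> {..<4})"
  proof -
    have 1: "rotate (?d j D (c, i)) = Some (?d 0 (shift D f) (if c = 0 then M else c - 1, i))"
      if "c \<le> M" "i < 4" for c i
      using that digit[of i] assms(2) by (auto simp: shift_def simp del: new_bit.simps)
    have 2: "(\<lambda>(c, i). (if c = 0 then M else c - 1, i)) ` ({..M} \<times> {..<4}) = {..M} \<times> {..<(4::nat)}"
    proof (intro equalityI subsetI)
      fix y assume "y \<in> {..M} \<times> {..<(4::nat)}"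
      then obtain c i where y: "y = (c, i)" "c \<le> M" "i < 4" by auto
      show "y \<in> (\<lambda>(c, i). (if c = 0 then M else c - 1, i)) ` ({..M} \<times> {..<4})"
        by (rule image_eqI[where x = "(if c = M then 0 else Suc c, i)"]) (use y in auto)
    qed auto
    have "rotate ` ?d j D ` ({..M} \<times> {..<4})
      = (\<lambda>y. Some (?d 0 (shift D f) y)) ` (\<lambda>(c, i). (if c = 0 then M else c - 1, i)) ` ({..M} \<times> {..<4})"
      unfolding image_image by (intro image_cong refl) (use 1 in \<open>auto simp del: rotate.simps\<close>)
    then show ?thesis unfolding 2 image_image .
  qed
  finally show ?thesis
    by (auto simp: config_def image_Un)
qed

section \<open>The potential and the lower bound\<close>

definition digit :: "(nat \<Rightarrow> bool) \<Rightarrow> nat" where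
  "digit f = of_bool (f 0) + 2 * of_bool (f 1) + 4 * of_bool (f 2) + 8 * of_bool (f 3)"

text \<open>
  Position \<open>M\<close> has weight 0: the digit there is a dummy whose passage separates two rounds of
  the odometer.
\<close>
definition weight :: "nat \<Rightarrow> nat" where
  "weight p = (if p < M then 16 ^ p else 0)"

text \<open>At ring position \<open>p\<close>, cell \<open>c\<close> holds the digit of position \<open>c + p\<close> modulo \<open>M + 1\<close>.\<close>
definition val :: "nat \<Rightarrow> (nat \<Rightarrow> nat \<Rightarrow> bool) \<Rightarrow> nat" where
  "val p D = (\<Sum>c\<le>M. digit (D c) * weight ((c + p) mod Suc M))"

definition potential :: "phase \<Rightarrow> nat \<Rightarrow> (nat \<Rightarrow> nat \<Rightarrow> bool) \<Rightarrow> nat" where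
  "potential x p D = val p D + (if x = Carry then 16 ^ p else 0)"

definition next_pos :: "nat \<Rightarrow> nat" where
  "next_pos p = (if p < M then Suc p else 0)"

lemma wrap: "(Suc c + M) mod Suc M = c mod Suc M"
  by (metis add_Suc_shift mod_add_self2)

text \<open>
  A rotation that advances the position leaves every digit at its position, so only the change of
  the head digit counts. The equation avoids subtraction.
\<close>
lemma val_shift:
  assumes "p \<le> M"
  shows "val (next_pos p) (shift D f) + digit (D 0) * weight p = val p D + digit f * weight p"
proof -
  have mod: "(c + next_pos p) mod Suc M = (Suc c + p) mod Suc M" for c
  proof (cases "p < M")
    case False
    then show ?thesis using assms wrap[of c] by (simp add: next_pos_def)
  qed (simp add: next_pos_def)
  have "val p D = digit (D 0) * weight (p mod Suc M)
      + (\<Sum>c<M. digit (D (Suc c)) * weight ((Suc c + p) mod Suc M))"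
    by (simp add: val_def sum.atMost_shift)
  moreover have "val (next_pos p) (shift D f)
      = (\<Sum>c<M. digit (D (Suc c)) * weight ((Suc c + p) mod Suc M)) + digit f * weight ((Suc M + p) mod Suc M)"
    unfolding val_def mod lessThan_Suc_atMost[symmetric] by (simp add: shift_def)
  moreover have "(Suc M + p) mod Suc M = p"
    using assms mod_add_self1[of "Suc M" p] by simp
  ultimately show ?thesis using assms by simp
qed

lemma val_top: "val M D = (\<Sum>c<M. digit (D (Suc c)) * 16 ^ c)"
proof -
  have "(Suc c + M) mod Suc M = c" if "c < M" for c
    using that wrap[of c] by simp
  then show ?thesis
    by (simp add: val_def sum.atMost_shift weight_def del: add_Suc add_Suc_right)
qed

text \<open>
  A reset at position \<open>M\<close> turns the ring but not the position. The lowest digit becomes the dummy and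
  the others move down by one place, which divides the value by 16, rounding down.
\<close>
lemma val_reset:
  assumes f0: "digit f = 0"
  shows "val M (shift D f) \<le> val M D"
proof -
  have "val M (shift D f) = (\<Sum>c<M. digit (shift D f (Suc c)) * 16 ^ c)" by (rule val_top)
  also have "\<dots> \<le> val M D"
  proof (cases M)
    case (Suc m)
    have "shift D f (Suc c) = D (Suc (Suc c))" if "c < m" for c
      unfolding shift_def using that Suc by simp
    moreover have "shift D f (Suc m) = f"
      unfolding shift_def using Suc by simp
    ultimately have "(\<Sum>c<M. digit (shift D f (Suc c)) * 16 ^ c) = (\<Sum>c<m. digit (D (Suc (Suc c))) * 16 ^ c)"
      using f0 by (simp add: Suc)
    also have "\<dots> \<le> (\<Sum>c<m. digit (D (Suc (Suc c))) * 16 ^ Suc c)" by (intro sum_mono) simp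
    also have "\<dots> \<le> val M D" unfolding val_top by (simp only: Suc sum.lessThan_Suc_shift)
    finally show ?thesis .
  qed (simp add: val_top)
  finally show ?thesis .
qed

lemma digit_copy:
  assumes "\<And>i. i < 4 \<Longrightarrow> new_bit k i (g i) = Some (f i)" "k \<le> 1"
  shows "digit f = digit g"
  using assms(1)[of 0] assms(1)[of 1] assms(1)[of 2] assms(1)[of 3] assms(2) by (simp add: digit_def)

lemma digit_inc:
  assumes "\<And>i. i < 4 \<Longrightarrow> new_bit k i (g i) = Some (f i)" "2 \<le> k" "k \<le> 5"
  shows "digit f = Suc (digit g)"
proof -
  from assms(2,3) consider "k = 2" | "k = 3" | "k = 4" | "k = 5" by linarith
  then show ?thesis
    using assms(1)[of 0] assms(1)[of 1] assms(1)[of 2] assms(1)[of 3]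
    by cases (auto simp: digit_def split: if_splits)
qed

lemma digit_carry:
  assumes "\<And>i. i < 4 \<Longrightarrow> new_bit 6 i (g i) = Some (f i)"
  shows "digit g = 15" "digit f = 0"
  using assms[of 0] assms[of 1] assms[of 2] assms[of 3] by (auto simp: digit_def split: if_splits)

lemma digit_reset:
  assumes "\<And>i. i < 4 \<Longrightarrow> new_bit 8 i (g i) = Some (f i)"
  shows "digit f = 0"
  using assms[of 0] assms[of 1] assms[of 2] assms[of 3] by (auto simp: digit_def)

text \<open>
  The bound \<open>16\<^sup>M\<close> excludes a carry at position \<open>M\<close>, hence the transition to \<open>Finish\<close>. Increment and
  carry preserve the potential exactly, the carry because \<open>15 * 16 ^ p + 16 ^ p = 16 ^ Suc p\<close>.
\<close>
lemma potential_step: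
  assumes "p \<le> M" "x \<noteq> Finish" "potential x p D < 16 ^ M"
    and def: "\<And>q. q \<in> config x p j D \<Longrightarrow> delta (q, a) \<noteq> None"
  obtains x' p' j' D' where "p' \<le> M" "x' \<noteq> Finish" "potential x' p' D' \<le> Suc (potential x p D)"
    "(\<lambda>q. delta (q, a)) ` config x p j D = Some ` config x' p' j' D'"
proof (cases "a = 0")
  case False
  have "delta (Phase x (min j 8), a) \<noteq> None"
    by (rule def) (simp add: config_def)
  with False have "a = 1" by (auto simp: delta_def split: if_splits)
  then show thesis using assms count_config[OF assms(1)] by (intro that[of p x D "Suc j"]) auto
next
  case a: True
  define k where "k = min j 8"
  have k8: "k \<le> 8" by (simp add: k_def)
  have ph: "rotate (Phase x k) \<noteq> None"
    using def[of "Phase x (min j 8)"] a by (auto simp: delta_def config_def k_def)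
  have pos: "rotate (Position p (min j (if p = M then 8 else 1))) \<noteq> None"
    using def[of "Position p (min j (if p = M then 8 else 1))"] a assms(1)
    by (auto simp: delta_def config_def simp del: rotate.simps split: if_splits)
  have bit: "new_bit k i (D 0 i) \<noteq> None" if "k \<noteq> 7" "i < 4" for i
  proof -
    have "Bit 0 i (D 0 i) k \<in> config x p j D"
      using that unfolding config_def k_def by (auto intro!: image_eqI[where x = "(0, i)"])
    from def[OF this] show ?thesis using a that k8
      by (auto simp: delta_def simp del: new_bit.simps split: if_splits)
  qed
  define f where "f i = the (new_bit k i (D 0 i))" for i
  have f: "new_bit k i (D 0 i) = Some (f i)" if "k \<noteq> 7" "i < 4" for i
    using bit[OF that] by (auto simp: f_def simp del: new_bit.simps)
  have carry: "x = Carry \<Longrightarrow> p < M"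
    using assms(1,3) by (cases "p = M") (auto simp: potential_def)
  have k7: "k \<noteq> 7" using ph assms(2) by (cases x) auto
  have step: "(\<lambda>q. delta (q, a)) ` config x p j D = Some ` config x' p' 0 (shift D f)"
    if "p' \<le> M" "rotate (Phase x k) = Some (Phase x' 0)"
      "rotate (Position p (min k (if p = M then 8 else 1))) = Some (Position p' 0)" for x' p'
  proof -
    have "min k (if p = M then 8 else 1) = min j (if p = M then 8 else 1)"
      by (auto simp: k_def min_def)
    then show ?thesis
      using rotate_config[of p j p' D f x x'] that assms(1) k7 f a unfolding k_def by simp
  qed
  \<comment> \<open>The phase leaves only these operations; the position is what confines a start to \<open>M\<close>.\<close>
  consider (start) "x = Copy" "k = 0" "p = M" | (copy) "x = Copy" "k = 1"
    | (inc) "x = Carry" "2 \<le> k" "k \<le> 5" | (overflow) "x = Carry" "k = 6" | (reset) "k = 8"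
  proof (cases "k = 8")
    case False
    have "k = 0 \<Longrightarrow> p = M" using pos assms(1) by (auto simp: k_def split: if_splits)
    moreover have "k = 1 \<or> k = 0" if "x = Copy"
      using that ph False k8 by (auto split: if_splits)
    moreover have "k = 0 \<or> (2 \<le> k \<and> k \<le> 5) \<or> k = 6" if "x = Carry"
      using that ph False k8 by (auto split: if_splits)
    ultimately show thesis using assms(2) carry that by (cases x) auto
  qed (use that in blast)
  then show thesis
  proof cases
    case start
    have "potential Carry 0 (shift D f) \<le> Suc (potential x p D)"
      using val_shift[of p D f] digit_copy[OF f] start k7 assms(1) by (simp add: potential_def next_pos_def)
    then show thesis
      using assms(1) start by (intro that[of 0 Carry "shift D f" 0] step) (auto simp: next_pos_def)
  next
    case copy
    have "potential Copy (next_pos p) (shift D f) \<le> Suc (potential x p D)"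
      using val_shift[of p D f] digit_copy[OF f] copy k7 assms(1) by (simp add: potential_def)
    then show thesis
      using assms(1) copy by (intro that[of "next_pos p" Copy "shift D f" 0] step) (auto simp: next_pos_def)
  next
    case inc
    have "potential Copy (next_pos p) (shift D f) \<le> Suc (potential x p D)"
      using val_shift[of p D f] digit_inc[OF f] inc k7 assms(1) carry by (simp add: potential_def weight_def)
    then show thesis
      using assms(1) inc carry by (intro that[of "next_pos p" Copy "shift D f" 0] step) (auto simp: next_pos_def)
  next
    case overflow
    have "potential Carry (next_pos p) (shift D f) \<le> Suc (potential x p D)"
      using val_shift[of p D f] digit_carry[of "D 0" f] f overflow assms(1) carry
      by (simp add: potential_def weight_def next_pos_def del: new_bit.simps)
    then show thesis
      using assms(1) overflow carry by (intro that[of "next_pos p" Carry "shift D f" 0] step) (auto simp: next_pos_def)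
  next
    case reset
    have f0: "digit f = 0" using digit_reset[of "D 0" f] f reset by simp
    define p' where "p' = (if p < M then Suc p else M)"
    have "val p' (shift D f) \<le> val p D"
    proof (cases "p < M")
      case True
      then show ?thesis using val_shift[of p D f] f0 by (simp add: p'_def next_pos_def)
    next
      case False
      then show ?thesis using val_reset[OF f0] assms(1) by (simp add: p'_def)
    qed
    then have "potential Copy p' (shift D f) \<le> Suc (potential x p D)"
      by (simp add: potential_def)
    then show thesis
      using assms(1) reset by (intro that[of p' Copy "shift D f" 0] step) (auto simp: next_pos_def p'_def)
  qed
qed


lemma lower_bound:
  assumes "p \<le> M" "x \<noteq> Finish" "potential x p D + length w < 16 ^ M"
  shows "\<not> (\<forall>q\<in>config x p j D. run delta q w = Some r)"
  using assms
proof (induction w arbitrary: p x j D)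
  case Nil
  have "Phase x (min j 8) \<in> config x p j D" "\<exists>j'. Position p j' \<in> config x p j D"
    by (auto simp: config_def)
  then show ?case by (metis run_Nil option.inject state.distinct(7))
next
  case (Cons a w)
  show ?case
  proof
    assume sync: "\<forall>q\<in>config x p j D. run delta q (a # w) = Some r"
    then have "delta (q, a) \<noteq> None" if "q \<in> config x p j D" for q
      using bspec[OF sync that] by (auto simp: run_Cons bind_eq_Some_conv)
    moreover have "potential x p D < 16 ^ M" using Cons.prems by simp
    ultimately obtain x' p' j' D' where step: "p' \<le> M" "x' \<noteq> Finish" "potential x' p' D' \<le> Suc (potential x p D)"
      "(\<lambda>q. delta (q, a)) ` config x p j D = Some ` config x' p' j' D'"
      using potential_step[OF Cons.prems(1,2)] by metis
    have "run delta q' w = Some r" if "q' \<in> config x' p' j' D'" for q'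
    proof -
      have "Some q' \<in> (\<lambda>q. delta (q, a)) ` config x p j D" using step(4) that by auto
      then obtain q where "q \<in> config x p j D" "delta (q, a) = Some q'" by auto
      then show ?thesis using bspec[OF sync, of q] by (simp add: run_Cons)
    qed
    then show False using Cons.IH[of p' x' D' j'] step Cons.prems by auto
  qed
qed

text \<open>
  A word defined on all states is defined on the zero configuration. This spares any analysis
  of the sets that arise from the full state set before the resets are complete.
\<close>
lemma sync_word_length:
  assumes "careful_sync_word states A delta w"
  shows "16 ^ M \<le> length w"
proof (rule ccontr)
  assume "\<not> 16 ^ M \<le> length w"
  then have "potential Copy M (\<lambda>_ _. False) + length w < 16 ^ M"
    by (simp add: potential_def val_def digit_def)
  from lower_bound[OF _ _ this, of 0] show False
    using assms config_legal[of M] unfolding careful_sync_word_def states_def by fastforce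
qed

section \<open>Existence of a synchronizing word\<close>

text \<open>
  Inclusion in \<open>T\<close> instead of equality with the image lets sets of states be estimated from above,
  which is enough for merging.
\<close>
definition reaches :: "state set \<Rightarrow> state set \<Rightarrow> bool" where
  "reaches S T \<longleftrightarrow> (\<exists>w\<in>lists {0, 1}. \<forall>q\<in>S. \<exists>q'\<in>T. run delta q w = Some q')"

lemma reaches_subset: "S \<subseteq> T \<Longrightarrow> reaches S T"
  unfolding reaches_def by (rule bexI[of _ "[]"]) (auto simp: run_Nil)

lemma reaches_trans [trans]: "reaches S T \<Longrightarrow> reaches T U \<Longrightarrow> reaches S U"
  unfolding reaches_def
proof (elim bexE)
  fix u v assume "u \<in> lists {0, 1}" "v \<in> lists {0, 1}"
    "\<forall>q\<in>S. \<exists>q'\<in>T. run delta q u = Some q'" "\<forall>q\<in>T. \<exists>q'\<in>U. run delta q v = Some q'"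
  then show "\<exists>w\<in>lists {0, 1}. \<forall>q\<in>S. \<exists>q'\<in>U. run delta q w = Some q'"
    by (intro bexI[of _ "u @ v"]) (fastforce simp: run_append)+
qed

lemma run_count: "legal q \<Longrightarrow> run delta q (replicate k 1) = Some ((count ^^ k) q)"
proof (induction k arbitrary: q)
  case (Suc k)
  then show ?case
    using legal_count[of q] by (simp add: run_Cons delta_def funpow_swap1)
qed (simp add: run_Nil)

lemma legal_funpow: "legal q \<Longrightarrow> legal ((count ^^ k) q)"
  by (induction k) (auto simp: legal_count)

lemma reaches_op:
  assumes "\<And>q. q \<in> S \<Longrightarrow> legal q" "\<And>q. q \<in> S \<Longrightarrow> \<exists>q'\<in>T. rotate ((count ^^ k) q) = Some q'"
  shows "reaches S T"
proof -
  have "run delta q (replicate k 1 @ [0]) = rotate ((count ^^ k) q)" if "q \<in> S" for q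
    using run_count[OF assms(1)[OF that]] legal_funpow[OF assms(1)[OF that]]
    by (simp add: run_snoc delta_apply)
  then show ?thesis unfolding reaches_def using assms(2)
    by (intro bexI[of _ "replicate k 1 @ [0]"]) auto
qed

lemma count_Phase: "j \<le> 8 \<Longrightarrow> (count ^^ k) (Phase x j) = Phase x (min (j + k) 8)"
  by (induction k) auto

lemma count_Bit:
  "legal (Bit c i b j) \<Longrightarrow> (count ^^ k) (Bit c i b j) = Bit c i b (if c = 0 then min (j + k) 8 else 0)"
  by (induction k) (auto split: if_splits)

lemma count_Position:
  "legal (Position p j) \<Longrightarrow> (count ^^ k) (Position p j) = Position p (min (j + k) (if p = M then 8 else 1))"
  by (induction k) (auto split: if_splits)

lemma count_Spare: "(count ^^ 8) (Spare k) = Phase Copy 8"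
proof -
  have "(count ^^ Suc 7) (Spare k) = (count ^^ 7) (Phase Copy 8)"
    by (simp only: funpow_Suc_right o_apply count.simps)
  then show ?thesis by (simp add: count_Phase)
qed

text \<open>
  An upper estimate of the states left after one reset and then \<open>k\<close> more: each adds a zero cell at the
  end of the ring and moves the remaining positions closer to \<open>M\<close>, where they stay and merge.
\<close>
definition resetting :: "nat \<Rightarrow> state set" where
  "resetting k = {q. case q of
       Bit c i b j \<Rightarrow> c \<le> M \<and> i < 4 \<and> (b \<longrightarrow> c + k \<le> M) \<and> j = 0
     | Phase x j \<Rightarrow> x = Copy \<and> j = 0
     | Position p j \<Rightarrow> p \<le> M \<and> min k M \<le> p \<and> j = 0
     | Spare _ \<Rightarrow> False}"

text \<open>
  An upper estimate of the states left after \<open>k\<close> erasures. The erased cells are empty, so the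
  survivors, turned by \<open>k\<close> cells, occupy the front of the ring.
\<close>
definition erasing :: "nat \<Rightarrow> state set" where
  "erasing k = {q. case q of
       Bit c i b j \<Rightarrow> c + k \<le> M \<and> i < 4 \<and> j = 0
     | Phase x j \<Rightarrow> x = Finish \<and> j = 0
     | Position p j \<Rightarrow> p = k \<and> p \<le> M \<and> j = 0
     | Spare _ \<Rightarrow> False}"

lemma reset_states: "reaches states (resetting 0)"
proof (rule reaches_op[where k = 8])
  fix q assume "q \<in> states"
  then show "\<exists>q'\<in>resetting 0. rotate ((count ^^ 8) q) = Some q'"
    by (cases q) (auto simp: states_def resetting_def count_Phase count_Bit count_Position count_Spare
        simp del: legal.simps simp add: legal.simps)
qed (simp add: states_def)

lemma reset_step: "reaches (resetting k) (resetting (Suc k))"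
proof (rule reaches_op[where k = 8])
  fix q assume "q \<in> resetting k"
  then show "\<exists>q'\<in>resetting (Suc k). rotate ((count ^^ 8) q) = Some q'"
    by (cases q) (auto simp: resetting_def count_Phase count_Bit count_Position)
qed (auto simp: resetting_def split: state.splits)

lemma erase_step: "reaches (erasing k) (erasing (Suc k))"
proof (rule reaches_op[where k = 7])
  fix q assume "q \<in> erasing k"
  then show "\<exists>q'\<in>erasing (Suc k). rotate ((count ^^ 7) q) = Some q'"
    by (cases q) (auto simp: erasing_def count_Phase count_Bit count_Position)
qed (auto simp: erasing_def split: state.splits)

lemma reaches_funpow:
  assumes "\<And>k. reaches (S k) (S (Suc k))"
  shows "reaches (S 0) (S n)"
proof (induction n)
  case (Suc n)
  from this assms show ?case by (rule reaches_trans)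
qed (simp add: reaches_subset)

lemma reset: "reaches states (config Copy M 0 (\<lambda>_ _. False))"
proof -
  note reset_states
  also have "reaches (resetting 0) (resetting (Suc M))"
    by (rule reaches_funpow) (rule reset_step)
  also have "resetting (Suc M) \<subseteq> config Copy M 0 (\<lambda>_ _. False)"
  proof
    fix q assume "q \<in> resetting (Suc M)"
    then show "q \<in> config Copy M 0 (\<lambda>_ _. False)"
      by (cases q) (auto simp: resetting_def config_def)
  qed
  then have "reaches (resetting (Suc M)) (config Copy M 0 (\<lambda>_ _. False))"
    by (rule reaches_subset)
  finally show ?thesis .
qed

lemma reaches_letter:
  assumes "a \<in> {0, 1}" "(\<lambda>q. delta (q, a)) ` S = Some ` T"
  shows "reaches S T"
  unfolding reaches_def
proof (rule bexI[of _ "[a]"])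
  have "delta (q, a) \<in> Some ` T" if "q \<in> S" for q
    using that assms(2) by blast
  then show "\<forall>q\<in>S. \<exists>q'\<in>T. run delta q [a] = Some q'"
    by (auto simp: run_Cons run_Nil)
qed (use assms(1) in auto)

lemma config_op:
  assumes "p \<le> M" "k \<le> 6" "p' \<le> M"
    and "\<And>i. i < 4 \<Longrightarrow> new_bit k i (D 0 i) = Some (f i)"
    and "rotate (Phase x k) = Some (Phase x' 0)"
    and "rotate (Position p (min k (if p = M then 8 else 1))) = Some (Position p' 0)"
  shows "reaches (config x p 0 D) (config x' p' 0 (shift D f))"
proof -
  have "reaches (config x p j D) (config x p (Suc j) D)" for j
    by (rule reaches_letter[of 1]) (simp_all add: count_config[OF assms(1)] del: One_nat_def)
  then have "reaches (config x p 0 D) (config x p k D)"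
    by (rule reaches_funpow)
  also have "min k 8 = k" using assms(2) by simp
  then have "reaches (config x p k D) (config x' p' 0 (shift D f))"
    using rotate_config[of p k p' D f x x'] assms by (intro reaches_letter[of 0]) auto
  finally show ?thesis .
qed

lemma copy_chain:
  assumes "p \<le> M"
  shows "\<exists>D'. reaches (config Copy p 0 D) (config Copy M 0 D') \<and> val M D' = val p D"
  using assms
proof (induction p arbitrary: D rule: inc_induct)
  case (step p)
  obtain D' where "reaches (config Copy (Suc p) 0 (shift D (D 0))) (config Copy M 0 D')"
    "val M D' = val (Suc p) (shift D (D 0))"
    using step.IH by blast
  moreover have "reaches (config Copy p 0 D) (config Copy (Suc p) 0 (shift D (D 0)))"
    using step by (intro config_op[where k = 1]) auto
  moreover have "val (Suc p) (shift D (D 0)) = val p D"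
    using val_shift[of p D "D 0"] step by (simp add: next_pos_def)
  ultimately show ?case by (metis reaches_trans)
qed (auto intro: reaches_subset)

text \<open>
  Either the carry is absorbed by the first digit other than 15, whose lowest zero bit selects the
  increment, or all digits from position \<open>p\<close> on are 15 and the carry comes to position \<open>M\<close>.
\<close>
lemma carry_chain:
  assumes "p \<le> M"
  shows "\<exists>D'. reaches (config Carry p 0 D) (config Carry M 0 D')
    \<or> reaches (config Carry p 0 D) (config Copy M 0 D') \<and> val M D' = val p D + 16 ^ p"
  using assms
proof (induction p arbitrary: D rule: inc_induct)
  case (step p)
  show ?case
  proof (cases "\<forall>i<4. D 0 i")
    case True
    let ?D = "shift D (\<lambda>_. False)"
    have new: "new_bit 6 i (D 0 i) = Some False" if "i < 4" for i
      using that True by auto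
    have "reaches (config Carry p 0 D) (config Carry (Suc p) 0 ?D)"
      using step new by (intro config_op[where k = 6]) (auto simp del: new_bit.simps)
    moreover have "val (Suc p) ?D + 16 ^ Suc p = val p D + 16 ^ p"
      using val_shift[of p D "\<lambda>_. False"] digit_carry[of "D 0" "\<lambda>_. False"] new step
      by (simp add: next_pos_def weight_def del: new_bit.simps)
    ultimately show ?thesis using step.IH[of ?D] by (metis reaches_trans)
  next
    case False
    define k where "k = (LEAST i. \<not> D 0 i)"
    define f where "f i = (if i < k then False else if i = k then True else D 0 i)" for i
    have k: "k < 4" "\<not> D 0 k" "i < k \<Longrightarrow> D 0 i" for i
    proof -
      obtain i where i: "i < 4" "\<not> D 0 i" using False by auto
      then show "k < 4" unfolding k_def by (meson Least_le le_less_trans)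
      show "\<not> D 0 k" unfolding k_def using i(2) by (rule LeastI)
    qed (use not_less_Least k_def in blast)
    have new: "new_bit (k + 2) i (D 0 i) = Some (f i)" if "i < 4" for i
      using that k by (auto simp: f_def)
    have "reaches (config Carry p 0 D) (config Copy (Suc p) 0 (shift D f))"
      using step new k(1) by (intro config_op[where k = "k + 2"]) (auto simp del: new_bit.simps)
    moreover have "val (Suc p) (shift D f) = val p D + 16 ^ p"
      using val_shift[of p D f] digit_inc[of "k + 2" "D 0" f] new step k(1)
      by (simp add: next_pos_def weight_def del: new_bit.simps)
    ultimately show ?thesis using copy_chain[of "Suc p" "shift D f"] step by (metis Suc_leI reaches_trans)
  qed
qed (auto intro: reaches_subset)

lemma val_bound: "val M D < 16 ^ M"
proof -
  have "(\<Sum>c<n. digit (F c) * 16 ^ c) < 16 ^ n" for n and F :: "nat \<Rightarrow> nat \<Rightarrow> bool"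
  proof (induction n)
    case (Suc n)
    have "digit (F n) \<le> 15" by (simp add: digit_def)
    then have "digit (F n) * 16 ^ n \<le> 15 * 16 ^ n" by (rule mult_right_mono) simp
    then show ?case unfolding sum.lessThan_Suc power_Suc using Suc.IH by linarith
  qed simp
  then show ?thesis unfolding val_top .
qed

text \<open>Each round of the ring adds 1 to the value, which stays below \<open>16\<^sup>M\<close> by \<open>val_bound\<close>.\<close>
lemma count_up: "\<exists>D'. reaches (config Copy M 0 D) (config Carry M 0 D')"
proof (induction "16 ^ M - val M D" arbitrary: D rule: less_induct)
  case less
  let ?D = "shift D (D 0)"
  have start: "reaches (config Copy M 0 D) (config Carry 0 0 ?D)"
    by (intro config_op[where k = 0]) auto
  have val: "val 0 ?D = val M D"
    using val_shift[of M D "D 0"] by (simp add: next_pos_def)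
  from carry_chain[of 0 ?D] obtain D' where "reaches (config Carry 0 0 ?D) (config Carry M 0 D') \<or>
      reaches (config Carry 0 0 ?D) (config Copy M 0 D') \<and> val M D' = Suc (val M D)"
    using val by auto
  then show ?case
  proof
    assume D': "reaches (config Carry 0 0 ?D) (config Copy M 0 D') \<and> val M D' = Suc (val M D)"
    then have "16 ^ M - val M D' < 16 ^ M - val M D" using val_bound[of D] by simp
    from less[OF this] start D' show ?case by (metis reaches_trans)
  qed (use start reaches_trans in blast)
qed

lemma finish: "reaches (config Carry M 0 D) {Phase Finish 0}"
proof -
  have "reaches (config Carry M 0 D) (config Finish 0 0 (shift D (D 0)))"
    by (intro config_op[where k = 0]) auto
  also have "config Finish 0 0 (shift D (D 0)) \<subseteq> erasing 0"
    by (auto simp: config_def erasing_def)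
  then have "reaches (config Finish 0 0 (shift D (D 0))) (erasing 0)"
    by (rule reaches_subset)
  also have "reaches (erasing 0) (erasing (Suc M))"
    by (rule reaches_funpow) (rule erase_step)
  also have "erasing (Suc M) \<subseteq> {Phase Finish 0}"
  proof
    fix q assume "q \<in> erasing (Suc M)"
    then show "q \<in> {Phase Finish 0}"
      by (cases q) (auto simp: erasing_def)
  qed
  then have "reaches (erasing (Suc M)) {Phase Finish 0}"
    by (rule reaches_subset)
  finally show ?thesis .
qed

lemma sync_word_exists:
  assumes "{0, 1} \<subseteq> A"
  shows "carefully_synchronizing states A delta"
proof -
  obtain D where "reaches (config Copy M 0 (\<lambda>_ _. False)) (config Carry M 0 D)"
    using count_up by blast
  then have "reaches states {Phase Finish 0}"
    using reset finish by (blast intro: reaches_trans)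
  then obtain w where "w \<in> lists {0, 1}" "\<forall>q\<in>states. run delta q w = Some (Phase Finish 0)"
    by (auto simp: reaches_def)
  moreover have "Phase Finish 0 \<in> states" by (simp add: states_def)
  ultimately show ?thesis
    using lists_mono[OF assms]
    unfolding carefully_synchronizing_def careful_sync_word_def by blast
qed

lemma pfa_states:
  assumes "finite states" "finite A" "{0, 1} \<subseteq> A"
  shows "pfa states A delta"
proof
  have letter: "legal q \<and> (a = 0 \<and> rotate q = Some q' \<or> a = 1 \<and> q' = count q)"
    if "delta (q, a) = Some q'" for q a q'
    using that by (auto simp: delta_def split: if_splits)
  show "dom delta \<subseteq> states \<times> A"
    using letter assms(3) unfolding states_def by fast
  show "ran delta \<subseteq> states"
    using letter legal_count legal_rotate unfolding states_def ran_def by fast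
qed (use assms in auto)

lemma shortest_ge:
  assumes "{0, 1} \<subseteq> A"
  shows "16 ^ M \<le> shortest_sync_length states A delta"
proof -
  let ?P = "\<lambda>k. \<exists>w. careful_sync_word states A delta w \<and> length w = k"
  obtain w where "careful_sync_word states A delta w"
    using sync_word_exists[OF assms] by (auto simp: carefully_synchronizing_def)
  then have "?P (length w)" by blast
  then have "?P (Least ?P)" by (rule LeastI)
  then obtain v where "careful_sync_word states A delta v" "length v = Least ?P" by blast
  then have "16 ^ M \<le> Least ?P" using sync_word_length by metis
  then show ?thesis unfolding shortest_sync_length_def .
qed

end

section \<open>The number of states\<close>

lemma card_states: "finite (states M 0)" "card (states M 0) \<le> 10 * M + 108"
proof -
  define S where "S = (\<lambda>(i, b, j). Bit 0 i b j) ` ({..<4} \<times> UNIV \<times> {..8})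
    \<union> (\<lambda>(c, i, b). Bit c i b 0) ` ({1..M} \<times> {..<4} \<times> UNIV)
    \<union> (\<lambda>(x, j). Phase x j) ` ({Copy, Carry, Finish} \<times> {..8})
    \<union> (\<lambda>(p, j). Position p j) ` ({..<M} \<times> {..1}) \<union> Position M ` {..8}"
  have sub: "states M 0 \<subseteq> S"
  proof
    fix q assume "q \<in> states M 0"
    then show "q \<in> S"
    proof (cases q)
      case (Phase x j)
      with \<open>q \<in> states M 0\<close> show ?thesis by (cases x) (auto simp: states_def S_def)
    qed (auto simp: states_def S_def image_iff split: if_splits)
  qed
  have fin: "finite S" by (simp add: S_def)
  have card: "card S \<le> 72 + 8 * M + 27 + 2 * M + 9"
    unfolding S_def
    by (intro order.trans[OF card_Un_le] add_mono order.trans[OF card_image_le])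
      (simp_all add: card_cartesian_product)
  show "finite (states M 0)" using sub fin by (rule finite_subset)
  show "card (states M 0) \<le> 10 * M + 108"
    using card_mono[OF fin sub] card by simp
qed

lemma states_Spare: "states M l = states M 0 \<union> Spare ` {..<l}"
proof (intro equalityI subsetI)
  fix q assume "q \<in> states M l"
  then show "q \<in> states M 0 \<union> Spare ` {..<l}" by (cases q) (auto simp: states_def)
next
  fix q assume "q \<in> states M 0 \<union> Spare ` {..<l}"
  then show "q \<in> states M l" by (cases q) (auto simp: states_def)
qed

lemma exact_states:
  assumes "10 * M + 108 \<le> n"
  obtains l where "finite (states M l)" "card (states M l) = n"
proof
  let ?l = "n - card (states M 0)"
  show "finite (states M ?l)" using card_states by (simp add: states_Spare[of M ?l])
  have "states M 0 \<inter> Spare ` {..<?l} = {}" by (auto simp: states_def)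
  then show "card (states M ?l) = n"
    using card_states[of M] assms
    by (simp add: states_Spare[of M ?l] card_Un_disjoint card_image inj_on_def)
qed

section \<open>Automata on natural numbers\<close>

text \<open>The claim asks for natural numbers as states, so the states are numbered.\<close>
lemma rename_states:
  fixes Q :: "'q set" and A :: "'a set"
  assumes "pfa Q A d" "finite Q"
  obtains Q' :: "nat set" and d' where "pfa Q' A d'" "card Q' = card Q"
    "\<And>w. careful_sync_word Q' A d' w \<longleftrightarrow> careful_sync_word Q A d w"
proof -
  interpret pfa Q A d by fact
  obtain f :: "'q \<Rightarrow> nat" where f: "inj_on f Q"
    using finite_imp_inj_to_nat_seg[OF assms(2)] by auto
  define g where "g = the_inv_into Q f"
  have gf: "g (f q) = q" if "q \<in> Q" for q
    using f that by (simp add: g_def the_inv_into_f_f)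
  define d' where "d' = (\<lambda>(y, a). if y \<in> f ` Q then map_option f (d (g y, a)) else None)"
  have d': "d' (f q, a) = map_option f (d (q, a))" if "q \<in> Q" for q a
    using that by (simp add: d'_def gf)
  have in_dom: "a \<in> A" if "d (q, a) = Some q'" for q a q'
    using domI[of d, OF that] dom_delta by blast
  have closed: "q' \<in> Q" if "d (q, a) = Some q'" for q a q'
    using that ran_delta by (auto simp: ran_def)
  have run': "run d' (f q) w = map_option f (run d q w)" if "q \<in> Q" for q w
    using that
  proof (induction w arbitrary: q)
    case (Cons a w)
    then show ?case
      using closed[of q a] by (cases "d (q, a)") (auto simp: run_Cons d')
  qed (simp add: run_Nil)
  have run_closed: "q' \<in> Q" if "q \<in> Q" "run d q w = Some q'" for q w q'
    using that by (induction w arbitrary: q) (auto simp: run_Nil run_Cons bind_eq_Some_conv dest: closed)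
  show thesis
  proof
    show "pfa (f ` Q) A d'"
    proof
      show "dom d' \<subseteq> f ` Q \<times> A"
        using in_dom by (auto simp: d'_def gf split: if_splits)
      show "ran d' \<subseteq> f ` Q"
        using closed by (auto simp: d'_def ran_def gf split: if_splits)
    qed (use assms(2) finite_alphabet in auto)
    show "card (f ` Q) = card Q" using f by (rule card_image)
    show "careful_sync_word (f ` Q) A d' w \<longleftrightarrow> careful_sync_word Q A d w" for w
    proof -
      have "run d' (f q) w = Some (f r) \<longleftrightarrow> run d q w = Some r" if "q \<in> Q" "r \<in> Q" for q r
        using that run'[of q w] run_closed[of q w] inj_onD[OF f] by auto
      then show ?thesis unfolding careful_sync_word_def by auto
    qed
  qed
qed

lemma slow_pfa:
  fixes A :: "nat set"
  assumes "10 * M + 108 \<le> n" "finite A" "{0, 1} \<subseteq> A"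
  obtains Q :: "nat set" and d where "pfa Q A d" "card Q = n" "carefully_synchronizing Q A d"
    "16 ^ M \<le> shortest_sync_length Q A d"
proof -
  obtain l where l: "finite (states M l)" "card (states M l) = n"
    using exact_states[OF assms(1)] .
  obtain Q :: "nat set" and d where Q: "pfa Q A d" "card Q = card (states M l)"
    "\<And>w. careful_sync_word Q A d w \<longleftrightarrow> careful_sync_word (states M l) A (delta M l) w"
    using rename_states[OF pfa_states[OF l(1) assms(2,3)] l(1)] by metis
  show thesis
    using that[OF Q(1)] Q(2,3) l(2) sync_word_exists[OF assms(3), of M l] shortest_ge[OF assms(3), of M l]
    by (simp add: carefully_synchronizing_def shortest_sync_length_def)
qed

text \<open>
  Rounding \<open>n\<close> down to \<open>10 M + 108\<close> loses at most 117 states against \<open>10 M\<close>, and 47 exceeds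
  \<open>2 * 117 / 5\<close>.
\<close>
lemma slow_pfa_powr:
  fixes b :: real and A :: "nat set"
  assumes "0 < b" "b < 2" "108 \<le> n" "finite A" "{0, 1} \<subseteq> A" "0 \<le> y" "y \<le> 2 * real n / 5"
  shows "\<exists>(Q :: nat set) d. pfa Q A d \<and> card Q = n \<and> carefully_synchronizing Q A d
    \<and> (1 / 2 ^ 47) * b powr y \<le> real (shortest_sync_length Q A d)"
proof -
  define M where "M = (n - 108) div 10"
  have M: "10 * M + 108 \<le> n" "n \<le> 10 * M + 117"
    using assms(3) unfolding M_def by presburger+
  obtain Q :: "nat set" and d where Q: "pfa Q A d" "card Q = n" "carefully_synchronizing Q A d"
    "16 ^ M \<le> shortest_sync_length Q A d"
    using slow_pfa[OF M(1) assms(4,5)] .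
  have "b powr y \<le> 2 powr y" using assms by (intro powr_mono2) auto
  also have "\<dots> \<le> 2 powr real (47 + 4 * M)"
    using assms(7) M(2) by (intro powr_mono) auto
  also have "\<dots> = 2 ^ 47 * 16 ^ M"
    by (simp only: powr_realpow zero_less_numeral power_add power_mult) simp
  also have "16 ^ M \<le> real (shortest_sync_length Q A d)"
    using Q(4) by (metis of_nat_le_iff of_nat_numeral of_nat_power)
  finally show ?thesis using Q by (intro exI[of _ Q] exI[of _ d]) simp
qed

theorem mainTheorem7:
  fixes \<epsilon> :: real
  assumes "0 < \<epsilon>" and "\<epsilon> < 2"
  shows "\<exists>(c::real) (N::nat). c > 0 \<and> (\<forall>n\<ge>N.
     (\<exists>(Q :: nat set) (\<Sigma> :: nat set) \<delta>.
        pfa Q \<Sigma> \<delta> \<and> card Q = n \<and> card \<Sigma> = 3 \<and>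
        carefully_synchronizing Q \<Sigma> \<delta> \<and>
        real (shortest_sync_length Q \<Sigma> \<delta>) \<ge> c * (2 - \<epsilon>) powr (2 * real n / 5)) \<and>
     (\<exists>(Q :: nat set) (\<Sigma> :: nat set) \<delta>.
        pfa Q \<Sigma> \<delta> \<and> card Q = n \<and> card \<Sigma> = 2 \<and>
        carefully_synchronizing Q \<Sigma> \<delta> \<and>
        real (shortest_sync_length Q \<Sigma> \<delta>) \<ge> c * (2 - \<epsilon>) powr (real n / 3)))"
proof (intro exI[of _ "1 / 2 ^ 47"] exI[of _ 108] conjI allI impI)
  fix n :: nat assume n: "108 \<le> n"
  show "\<exists>(Q :: nat set) (\<Sigma> :: nat set) \<delta>.
        pfa Q \<Sigma> \<delta> \<and> card Q = n \<and> card \<Sigma> = 3 \<and>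
        carefully_synchronizing Q \<Sigma> \<delta> \<and>
        real (shortest_sync_length Q \<Sigma> \<delta>) \<ge> 1 / 2 ^ 47 * (2 - \<epsilon>) powr (2 * real n / 5)"
  proof -
    obtain Q :: "nat set" and d where Q: "pfa Q ({0, 1, 2} :: nat set) d" "card Q = n" "carefully_synchronizing Q {0, 1, 2} d"
      "(1 / 2 ^ 47) * (2 - \<epsilon>) powr (2 * real n / 5) \<le> real (shortest_sync_length Q {0, 1, 2} d)"
      using slow_pfa_powr[of "2 - \<epsilon>" n "{0, 1, 2}" "2 * real n / 5"] assms n by fastforce
    show ?thesis
      by (rule exI[of _ Q], rule exI[of _ "{0, 1, 2}"], rule exI[of _ d]) (use Q in simp)
  qed
  show "\<exists>(Q :: nat set) (\<Sigma> :: nat set) \<delta>.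
        pfa Q \<Sigma> \<delta> \<and> card Q = n \<and> card \<Sigma> = 2 \<and>
        carefully_synchronizing Q \<Sigma> \<delta> \<and>
        real (shortest_sync_length Q \<Sigma> \<delta>) \<ge> 1 / 2 ^ 47 * (2 - \<epsilon>) powr (real n / 3)"
  proof -
    obtain Q :: "nat set" and d where Q: "pfa Q ({0, 1} :: nat set) d" "card Q = n" "carefully_synchronizing Q {0, 1} d"
      "(1 / 2 ^ 47) * (2 - \<epsilon>) powr (real n / 3) \<le> real (shortest_sync_length Q {0, 1} d)"
      using slow_pfa_powr[of "2 - \<epsilon>" n "{0, 1}" "real n / 3"] assms n by fastforce
    show ?thesis
      by (rule exI[of _ Q], rule exI[of _ "{0, 1}"], rule exI[of _ d]) (use Q in simp)
  qed
qed simp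

end
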